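(* Let $n\geq 0$ and set $q_{p,n}=0$ for $p>n$. Let $\Lambda^t$ be the upper triangular matrix of the vectors $(T^j)_{j\ge 0}$ in the basis $(L_i)_{i\geq 0}$ of $\mathbb{R}[T]$, with coefficients $\lambda_{j,i}$ defined by $T^j=\sum_{i=0}^{j}\lambda_{j,i}L_i(T)$. Then $(q_{p,n})_{p\ge 0}$ is the eigenvector of $\Lambda^t$ associated to the eigenvalue $(n+1)!$, normalized so that $q_{n,n}=1$ and $q_{p,n}=0$ for $p>n$, where $q_{p,n}$ is the coordinate of index $p+1$; that is, $q_{n,n}=1$ and for every $p\geq 0$, $$\sum_{h\geq p}\lambda_{h+1,p+1}\,q_{h,n}=(n+1)!\,q_{p,n}.$$ Moreover, for every $0\leq p<n$, $$q_{p,n}=\sum_{(p_1,\ldots,p_j)\in\mathcal{P}_{p,n}}\frac{\lambda_{n+1,p_j}\lambda_{p_j,p_{j-1}}\cdots\lambda_{p_2,p_1}}{(\lambda_{n+1,n+1}-\lambda_{p_j,p_j})\cdots(\lambda_{n+1,n+1}-\lambda_{p_1,p_1})},$$ where $\mathcal{P}_{p,n}=\{(p_1,\ldots,p_j)\in\mathbb{N}^j \mid j\geq 1 \text{ and } p+1=p_1<\cdots<p_j<n+1\}$.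
   Context: $L_0=1$ and, for $j\geq1$, $L_j(T)=\frac{1}{j!}\prod_{i=0}^{j-1}(T-i)\in\mathbb{R}[T]$. For a finite simplicial complex $K$, $f_p(K)$ is the number of its $p$-dimensional simplices and $\mathrm{Sd}^d(K)$ is its $d$-th iterated barycentric subdivision. For $0\le p\le n$, the number $q_{p,n}>0$ is defined by $$q_{p,n}=\lim_{d\to+\infty}\frac{f_p(\mathrm{Sd}^d(K))}{(n+1)!^d f_n(K)},$$ where $K$ is any $n$-dimensional finite simplicial complex; it is a known theorem (Brenti–Welker, Delucchi–Pixton–Sabalka) that this limit exists, is positive and does not depend on $K$. *)

theory Defs
  imports
    "HOL-Analysis.Analysis"
    "HOL-Computational_Algebra.Polynomial"
    "HOL-Library.Nat_Bijection"
begin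

definition binom_poly :: "nat \<Rightarrow> real poly" where
  "binom_poly j = smult (1 / fact j) (\<Prod>i<j. [:- of_nat i, 1:])"

text \<open>
  The row \<open>lam j\<close> consists of the coordinates of the monomial \<open>T ^ j\<close> in the basis
  \<open>binom_poly\<close>; as the matrix is triangular, the entries with \<open>i > j\<close> are zero.
\<close>

definition lam :: "nat \<Rightarrow> nat \<Rightarrow> real" where
  "lam j = (THE c. monom 1 j = (\<Sum>i\<le>j. smult (c i) (binom_poly i)) \<and> (\<forall>i>j. c i = 0))"

text \<open>
  Finite abstract simplicial complexes; the empty set is not counted as a simplex.
\<close>

definition finite_simplicial_complex :: "'a set set \<Rightarrow> bool" where
  "finite_simplicial_complex K \<longleftrightarrow>
     finite K \<and> (\<forall>s\<in>K. finite s \<and> s \<noteq> {}) \<and>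
     (\<forall>s\<in>K. \<forall>t. t \<subseteq> s \<and> t \<noteq> {} \<longrightarrow> t \<in> K)"

definition face_number :: "nat \<Rightarrow> 'a set set \<Rightarrow> nat" where
  "face_number p K = card {s \<in> K. card s = p + 1}"

definition has_dimension :: "'a set set \<Rightarrow> nat \<Rightarrow> bool" where
  "has_dimension K n \<longleftrightarrow> (\<exists>s\<in>K. card s = n + 1) \<and> (\<forall>s\<in>K. card s \<le> n + 1)"

definition barycentric_subdivision :: "'a set set \<Rightarrow> 'a set set set" where
  "barycentric_subdivision K =
     {C. C \<subseteq> K \<and> C \<noteq> {} \<and> (\<forall>s\<in>C. \<forall>t\<in>C. s \<subseteq> t \<or> t \<subseteq> s)}"

text \<open>
  The vertices of the barycentric subdivision of \<open>K\<close> are the simplices of \<open>K\<close>, so the vertex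
  type changes. To be able to iterate, we work with complexes on natural numbers (every finite
  complex is isomorphic to such a one) and rename the vertices along \<^const>\<open>set_encode\<close>, which is
  injective on finite sets.
\<close>

definition Sd :: "nat set set \<Rightarrow> nat set set" where
  "Sd K = (\<lambda>C. set_encode ` C) ` barycentric_subdivision K"

text \<open>
  The common limit of the normalized face numbers for all complexes of dimension \<open>n\<close>.
\<close>

definition q :: "nat \<Rightarrow> nat \<Rightarrow> real" where
  "q p n =
     (if p \<le> n then
        (THE l. \<forall>K. finite_simplicial_complex K \<and> has_dimension K n \<longrightarrow>
           (\<lambda>d. real (face_number p ((Sd ^^ d) K)) / (fact (n + 1) ^ d * real (face_number n K)))
             \<longlonglongrightarrow> l)
      else 0)"

definition index_chains :: "nat \<Rightarrow> nat \<Rightarrow> nat list set" where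
  "index_chains p n =
     {ps. ps \<noteq> [] \<and> hd ps = p + 1 \<and> sorted_wrt (<) ps \<and> last ps < n + 1}"

end

theory Submission
  imports Defs
begin

text \<open>
  Every simplex of \<open>Sd K\<close> is a chain of simplices of \<open>K\<close>. The number of chains of \<open>p + 1\<close> nonempty
  subsets of a finite set \<open>s\<close> with top \<open>s\<close> satisfies, on removing the top, the same recursion in
  \<open>card s\<close> as the numbers \<open>lam (card s) (p + 1)\<close>. Hence the face numbers of the iterated subdivisions
  evolve by a triangular linear map whose diagonal entries are \<open>(p + 1)!\<close>. After division by
  \<open>(n + 1)! ^ d\<close>, downward induction on \<open>p\<close> shows that they converge to the eigenvector of this
  map for \<open>(n + 1)!\<close>, as \<open>y (d + 1) = a * y d + b d\<close> with \<open>0 \<le> a < 1\<close> and \<open>b\<close> converging to \<open>l\<close>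
  forces \<open>y\<close> to converge to \<open>l / (1 - a)\<close>. Solving the triangular system recursively yields the sum over
  index chains.
\<close>

section \<open>Expansion of monomials in the binomial basis\<close>

lemma poly_binom_poly_of_nat: "poly (binom_poly i) (of_nat m) = of_nat (m choose i)"
proof -
  have "poly (binom_poly i) (of_nat m) = (of_nat m gchoose i :: real)"
    by (simp add: binom_poly_def poly_prod gbinomial_prod_rev atLeast0LessThan)
  then show ?thesis by (simp add: binomial_gbinomial)
qed

text \<open>Rearranges the defining step \<open>(T - i) * L_i = (i + 1) * L_(i+1)\<close>; it drives
  the induction that expands \<open>T ^ j\<close>.\<close>

lemma binom_poly_mult_X:
  "[:0, 1:] * binom_poly i = smult (of_nat i) (binom_poly i) + smult (of_nat (Suc i)) (binom_poly (Suc i))"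
proof -
  have "smult (of_nat (Suc i)) (binom_poly (Suc i)) = [:- of_nat i, 1:] * binom_poly i"
    by (simp add: binom_poly_def mult.commute field_simps del: of_nat_Suc)
  also have "\<dots> = [:0, 1:] * binom_poly i - smult (of_nat i) (binom_poly i)"
    by (simp add: algebra_simps)
  finally show ?thesis by simp
qed

text \<open>Linear independence by evaluation: at the point \<open>m\<close> the terms with
  \<open>i > m\<close> vanish because \<open>m choose i = 0\<close>, those with \<open>i < m\<close>
  by induction, and \<open>c m\<close> remains.\<close>

lemma binomial_combination_eq_zero:
  fixes c :: "nat \<Rightarrow> real"
  assumes "\<And>m. (\<Sum>i\<le>N. c i * of_nat (m choose i)) = 0" and "i \<le> N"
  shows "c i = 0"
  using assms(2)
proof (induction i rule: less_induct)
  case (less m)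
  have "(\<Sum>i\<le>N. c i * of_nat (m choose i)) = (\<Sum>i\<in>{m}. c i * of_nat (m choose i))"
  proof (rule sum.mono_neutral_right)
    show "\<forall>i\<in>{..N} - {m}. c i * real (m choose i) = 0"
    proof
      fix i assume "i \<in> {..N} - {m}"
      then show "c i * real (m choose i) = 0"
        using less.IH[of i] by (cases "i < m") auto
    qed
  qed (use less.prems in auto)
  then show ?case using assms(1)[of m] by simp
qed

lemma monom_expansion_exists:
  "\<exists>c :: nat \<Rightarrow> real. monom 1 j = (\<Sum>i\<le>j. smult (c i) (binom_poly i)) \<and> (\<forall>i>j. c i = 0)"
proof (induction j)
  case 0
  show ?case
    by (rule exI[of _ "\<lambda>i. if i = 0 then 1 else 0"]) (simp add: binom_poly_def monom_0 one_pCons)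
next
  case (Suc j)
  then obtain c :: "nat \<Rightarrow> real" where c: "monom 1 j = (\<Sum>i\<le>j. smult (c i) (binom_poly i))"
    and z: "\<forall>i>j. c i = 0" by blast
  \<comment> \<open>The coefficient of \<open>L_i\<close> gets \<open>i * c i\<close> from
    \<open>T * L_i\<close> and \<open>i * c (i - 1)\<close> from \<open>T * L_(i-1)\<close>. For
    \<open>i = 0\<close> the factor \<open>i\<close> cancels the meaningless
    \<open>c (0 - 1)\<close>.\<close>
  define c' where "c' i = of_nat i * (c i + c (i - 1))" for i
  have "monom 1 (Suc j) = [:0, 1:] * monom (1::real) j"
    by (simp add: monom_Suc)
  also have "\<dots> = (\<Sum>i\<le>j. smult (c i) ([:0, 1:] * binom_poly i))"
    unfolding c sum_distrib_left by simp
  also have "\<dots> = (\<Sum>i\<le>j. smult (of_nat i * c i) (binom_poly i))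
      + (\<Sum>i\<le>j. smult (of_nat (Suc i) * c i) (binom_poly (Suc i)))"
    unfolding binom_poly_mult_X by (simp add: smult_add_right sum.distrib mult.commute del: of_nat_Suc)
  also have "(\<Sum>i\<le>j. smult (of_nat (Suc i) * c i) (binom_poly (Suc i)))
      = (\<Sum>i\<le>Suc j. smult (of_nat i * c (i - 1)) (binom_poly i))"
    by (simp add: sum.atMost_Suc_shift del: sum.atMost_Suc of_nat_Suc)
  also have "(\<Sum>i\<le>j. smult (of_nat i * c i) (binom_poly i))
      = (\<Sum>i\<le>Suc j. smult (of_nat i * c i) (binom_poly i))"
    using z by simp
  finally have "monom 1 (Suc j) = (\<Sum>i\<le>Suc j. smult (c' i) (binom_poly i))"
    by (simp only: c'_def sum.distrib[symmetric] smult_add_left[symmetric] distrib_left)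
  moreover have "\<forall>i>Suc j. c' i = 0" using z by (simp add: c'_def)
  ultimately show ?case by blast
qed

text \<open>Justifies the definite description in \<open>lam\<close>. Two expansions agree at all
  natural numbers, so their difference falls under linear independence.\<close>

lemma lam_unique_expansion:
  "\<exists>!c :: nat \<Rightarrow> real. monom 1 j = (\<Sum>i\<le>j. smult (c i) (binom_poly i)) \<and> (\<forall>i>j. c i = 0)"
proof (rule ex_ex1I[OF monom_expansion_exists])
  fix c c' :: "nat \<Rightarrow> real"
  assume c: "monom 1 j = (\<Sum>i\<le>j. smult (c i) (binom_poly i)) \<and> (\<forall>i>j. c i = 0)"
    and c': "monom 1 j = (\<Sum>i\<le>j. smult (c' i) (binom_poly i)) \<and> (\<forall>i>j. c' i = 0)"
  have "(\<Sum>i\<le>j. (c i - c' i) * of_nat (m choose i)) = 0" for m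
  proof -
    have "poly (\<Sum>i\<le>j. smult (c i) (binom_poly i)) (of_nat m)
        = poly (\<Sum>i\<le>j. smult (c' i) (binom_poly i)) (of_nat m)"
      using c c' by metis
    then show ?thesis
      by (simp add: poly_sum poly_binom_poly_of_nat left_diff_distrib sum_subtractf)
  qed
  from binomial_combination_eq_zero[OF this] have "i \<le> j \<Longrightarrow> c i = c' i" for i by simp
  with c c' show "c = c'" by (metis ext not_le)
qed

lemma
  shows monom_eq_sum_lam: "monom 1 j = (\<Sum>i\<le>j. smult (lam j i) (binom_poly i))"
    and lam_eq_0: "j < i \<Longrightarrow> lam j i = 0"
  using theI'[OF lam_unique_expansion[of j]] unfolding lam_def by blast+

text \<open>Padding with the zero entries lets powers of different exponents share one summation
  range.\<close>

lemma power_eq_sum_lam: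
  assumes "j \<le> N"
  shows "of_nat m ^ j = (\<Sum>i\<le>N. lam j i * of_nat (m choose i))"
proof -
  have "of_nat m ^ j = poly (monom 1 j) (of_nat m :: real)" by (simp add: poly_monom)
  also have "\<dots> = (\<Sum>i\<le>j. lam j i * of_nat (m choose i))"
    by (simp add: monom_eq_sum_lam poly_sum poly_binom_poly_of_nat)
  also have "\<dots> = (\<Sum>i\<le>N. lam j i * of_nat (m choose i))"
    using assms by (intro sum.mono_neutral_left) (auto simp: lam_eq_0)
  finally show ?thesis .
qed

text \<open>Applies the difference operator \<open>f(T + 1) - f(T)\<close>, which sends \<open>L\<^sub>p\<^sub>+\<^sub>1\<close> to \<open>L\<^sub>p\<close>, to both
  sides of the expansion of \<open>T ^ j\<close>.\<close>

lemma lam_Suc_right: "lam j (Suc p) = (\<Sum>k<j. of_nat (j choose k) * lam k p)"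
proof (cases "p \<le> j")
  case False
  then show ?thesis by (simp add: lam_eq_0)
next
  case True
  have "(\<Sum>p\<le>j. (lam j (Suc p) - (\<Sum>k<j. of_nat (j choose k) * lam k p)) * of_nat (m choose p)) = 0"
    for m
  proof -
    \<comment> \<open>Pascal's rule: with the upper bound \<open>Suc j\<close>, shifting the index
      brings the range back to \<open>p \<le> j\<close>.\<close>
    have "(\<Sum>p\<le>j. lam j (Suc p) * of_nat (m choose p))
        = (\<Sum>p\<le>Suc j. lam j p * of_nat (Suc m choose p)) - (\<Sum>p\<le>Suc j. lam j p * of_nat (m choose p))"
      by (simp add: sum.atMost_Suc_shift distrib_left sum.distrib del: sum.atMost_Suc)
    also have "\<dots> = of_nat (Suc m) ^ j - of_nat m ^ j"
      by (simp only: power_eq_sum_lam[of j "Suc j", symmetric])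
    also have "\<dots> = (\<Sum>k\<le>j. of_nat (j choose k) * of_nat m ^ k) - of_nat m ^ j"
      using binomial_ring[of "of_nat m :: real" 1 j] by (simp add: add.commute)
    also have "\<dots> = (\<Sum>k<j. of_nat (j choose k) * of_nat m ^ k)"
      by (simp flip: lessThan_Suc_atMost)
    also have "\<dots> = (\<Sum>k<j. \<Sum>p\<le>j. of_nat (j choose k) * lam k p * of_nat (m choose p))"
      by (intro sum.cong refl) (simp add: power_eq_sum_lam[of _ j] sum_distrib_left mult.assoc)
    also have "\<dots> = (\<Sum>p\<le>j. (\<Sum>k<j. of_nat (j choose k) * lam k p) * of_nat (m choose p))"
      by (subst sum.swap) (simp add: sum_distrib_right)
    finally show ?thesis by (simp add: left_diff_distrib sum_subtractf)
  qed
  from binomial_combination_eq_zero[OF this True] show ?thesis by simp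
qed

text \<open>Evaluation at \<open>T = 0\<close>.\<close>

lemma lam_0_right: "lam j 0 = (if j = 0 then 1 else 0)"
  using power_eq_sum_lam[of j j 0] by (cases j) (simp_all add: sum.atMost_shift)

text \<open>Triangularity leaves only the term \<open>k = j\<close> of the recursion, with factor
  \<open>Suc j\<close>. These are the eigenvalues of the matrix.\<close>

lemma lam_diag: "lam j j = fact j"
proof (induction j)
  case (Suc j)
  have "lam (Suc j) (Suc j) = (\<Sum>k\<in>{j}. of_nat (Suc j choose k) * lam k j)"
    unfolding lam_Suc_right by (intro sum.mono_neutral_right) (auto simp: lam_eq_0)
  with Suc show ?case by simp
qed (simp add: lam_0_right)

section \<open>Chains of subsets with a prescribed top\<close>

text \<open>The simplices of the subdivided simplex \<open>s\<close> that lie in no proper face of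
  \<open>s\<close>. The index \<open>p\<close> counts members, so the dimension is
  \<open>p - 1\<close>.\<close>

definition top_chains :: "'a set \<Rightarrow> nat \<Rightarrow> 'a set set set" where
  "top_chains s p = {C. C \<subseteq> Pow s - {{}} \<and> (\<forall>t\<in>C. \<forall>u\<in>C. t \<subseteq> u \<or> u \<subseteq> t) \<and> s \<in> C \<and> card C = p}"

lemma top_chainsD:
  assumes "C \<in> top_chains s p"
  shows "C \<subseteq> Pow s - {{}}" "s \<in> C" "card C = p" "\<forall>t\<in>C. \<forall>u\<in>C. t \<subseteq> u \<or> u \<subseteq> t"
  using assms unfolding top_chains_def by blast+

lemma finite_top_chains: "finite s \<Longrightarrow> finite (top_chains s p)"
  by (rule finite_subset[of _ "Pow (Pow s)"]) (auto simp: top_chains_def)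

lemma finite_chain_has_top:
  assumes "finite C" "C \<noteq> {}" "\<forall>t\<in>C. \<forall>u\<in>C. t \<subseteq> u \<or> u \<subseteq> t"
  shows "\<Union>C \<in> C"
  using assms
proof (induction C rule: finite_ne_induct)
  case (insert x C)
  then have "\<Union>C \<in> C" by blast
  then have "x \<subseteq> \<Union>C \<or> \<Union>C \<subseteq> x" using insert.prems by blast
  then have "\<Union>(insert x C) = \<Union>C \<or> \<Union>(insert x C) = x" by auto
  with \<open>\<Union>C \<in> C\<close> show ?case by auto
qed simp

text \<open>In a common chain each of the two tops would contain the other.\<close>

lemma disjoint_top_chains: "t \<noteq> u \<Longrightarrow> top_chains t p \<inter> top_chains u p' = {}"
  by (auto simp: top_chains_def)

text \<open>Removing \<open>s\<close> leaves a chain whose own top is a proper subset of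
  \<open>s\<close>; \<open>p > 0\<close> guarantees that this remainder is nonempty.\<close>

lemma top_chains_Suc:
  assumes "finite s" "s \<noteq> {}" "p > 0"
  shows "top_chains s (Suc p) = insert s ` (\<Union>t\<in>{t. t \<subset> s}. top_chains t p)"
proof (intro equalityI subsetI)
  fix C assume C: "C \<in> top_chains s (Suc p)"
  define D where "D = C - {s}"
  have fin: "finite C"
    using C assms(1) by (auto simp: top_chains_def intro: finite_subset)
  have card: "card D = p" and CD: "C = insert s D"
    using C by (auto simp: D_def top_chains_def)
  have "D \<noteq> {}" using card assms(3) by auto
  have top: "\<Union>D \<in> D"
    by (rule finite_chain_has_top[OF _ \<open>D \<noteq> {}\<close>]) (use fin C in \<open>auto simp: D_def top_chains_def\<close>)
  have "D \<in> top_chains (\<Union>D) p" "\<Union>D \<subset> s"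
    using C top card by (auto simp: top_chains_def D_def)
  with CD show "C \<in> insert s ` (\<Union>t\<in>{t. t \<subset> s}. top_chains t p)" by blast
next
  fix C assume "C \<in> insert s ` (\<Union>t\<in>{t. t \<subset> s}. top_chains t p)"
  then obtain t D where t: "t \<subset> s" and D: "D \<in> top_chains t p" and C: "C = insert s D" by blast
  note D' = top_chainsD[OF D]
  have "finite D" using D'(3) assms(3) card_gt_0_iff by metis
  moreover have "s \<notin> D" using D'(1) t by blast
  moreover have "insert s D \<subseteq> Pow s - {{}}" using D'(1) t assms(2) by blast
  moreover have "\<forall>t\<in>insert s D. \<forall>u\<in>insert s D. t \<subseteq> u \<or> u \<subseteq> t" using D'(1,4) t by blast
  ultimately show "C \<in> top_chains s (Suc p)"
    using D'(3) by (simp add: top_chains_def C)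
qed

lemma finite_proper_subsets: "finite s \<Longrightarrow> finite {t. t \<subset> s}"
  by (rule finite_subset[of _ "Pow s"]) auto

text \<open>Grouping the subsets by size produces the binomial sum of
  \<open>lam_Suc_right\<close>.\<close>

lemma sum_card_proper_subsets:
  fixes g :: "nat \<Rightarrow> real"
  assumes "finite s"
  shows "(\<Sum>t | t \<subset> s. g (card t)) = (\<Sum>k<card s. of_nat (card s choose k) * g k)"
proof -
  have fin: "finite {t. t \<subset> s}" using assms by (rule finite_proper_subsets)
  have img: "card ` {t. t \<subset> s} \<subseteq> {..<card s}" using assms by (auto intro: psubset_card_mono)
  have "(\<Sum>t | t \<subset> s. g (card t)) = (\<Sum>k<card s. \<Sum>t | t \<in> {t. t \<subset> s} \<and> card t = k. g (card t))"
    by (rule sum.group[OF fin _ img, symmetric]) simp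
  also have "\<dots> = (\<Sum>k<card s. of_nat (card s choose k) * g k)"
  proof (rule sum.cong[OF refl])
    fix k assume "k \<in> {..<card s}"
    then have "{t \<in> {t. t \<subset> s}. card t = k} = {t. t \<subseteq> s \<and> card t = k}" by auto
    then show "(\<Sum>t | t \<in> {t. t \<subset> s} \<and> card t = k. g (card t)) = of_nat (card s choose k) * g k"
      using n_subsets[OF assms, of k] by simp
  qed
  finally show ?thesis .
qed

text \<open>Splitting off the top on the left matches \<open>lam_Suc_right\<close> on the right. The
  common value is the number of surjections from \<open>s\<close> onto \<open>p + 1\<close>
  points.\<close>

lemma card_top_chains: "finite s \<Longrightarrow> real (card (top_chains s (Suc p))) = lam (card s) (Suc p)"
proof (induction p arbitrary: s)
  case 0
  show ?case
  proof (cases "s = {}")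
    case True
    then show ?thesis by (simp add: top_chains_def lam_eq_0)
  next
    case False
    then have "top_chains s (Suc 0) = {{s}}"
      by (auto simp: top_chains_def card_1_singleton_iff)
    \<comment> \<open>Only \<open>k = 0\<close> contributes, since \<open>lam k 0 = 0\<close> for
      \<open>k > 0\<close>.\<close>
    moreover have "lam (card s) (Suc 0) = (\<Sum>k\<in>{0}. of_nat (card s choose k) * lam k 0)"
      unfolding lam_Suc_right using False 0
      by (intro sum.mono_neutral_right) (auto simp: lam_0_right card_gt_0_iff)
    ultimately show ?thesis by (simp add: lam_0_right)
  qed
next
  case (Suc p)
  show ?case
  proof (cases "s = {}")
    case True
    then show ?thesis by (simp add: top_chains_def lam_eq_0)
  next
    case False
    have fin: "finite t" if "t \<subset> s" for t
      using that Suc.prems finite_subset by blast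
    have "card (top_chains s (Suc (Suc p))) = card (\<Union>t\<in>{t. t \<subset> s}. top_chains t (Suc p))"
      unfolding top_chains_Suc[OF Suc.prems False zero_less_Suc]
    proof (rule card_image, rule inj_onI)
      \<comment> \<open>No chain below a proper subset contains \<open>s\<close>, so inserting
        \<open>s\<close> can be undone.\<close>
      have notin: "s \<notin> C" if "C \<in> (\<Union>t\<in>{t. t \<subset> s}. top_chains t (Suc p))" for C
        using that by (auto dest!: top_chainsD(1))
      fix C D assume "C \<in> (\<Union>t\<in>{t. t \<subset> s}. top_chains t (Suc p))"
        "D \<in> (\<Union>t\<in>{t. t \<subset> s}. top_chains t (Suc p))" "insert s C = insert s D"
      then show "C = D" using notin[of C] notin[of D] by (metis insert_ident)
    qed
    also have "\<dots> = (\<Sum>t | t \<subset> s. card (top_chains t (Suc p)))"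
      using Suc.prems fin
      by (intro card_UN_disjoint)
        (simp_all add: disjoint_top_chains finite_top_chains finite_proper_subsets)
    finally have "real (card (top_chains s (Suc (Suc p)))) = (\<Sum>t | t \<subset> s. lam (card t) (Suc p))"
      using Suc.IH fin by simp
    then show ?thesis
      using sum_card_proper_subsets[OF Suc.prems, of "\<lambda>k. lam k (Suc p)"]
      by (simp add: lam_Suc_right[of "card s" "Suc p"])
  qed
qed

section \<open>Face numbers of the barycentric subdivision\<close>

text \<open>A chain in \<open>K\<close> is sorted under its largest simplex. Conversely, closure
  under faces puts every member of a chain below \<open>s\<close> into \<open>K\<close>.\<close>

lemma barycentric_subdivision_of_card:
  assumes "finite_simplicial_complex K"
  shows "{C \<in> barycentric_subdivision K. card C = Suc p} = (\<Union>s\<in>K. top_chains s (Suc p))"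
proof (intro equalityI subsetI)
  fix C assume C: "C \<in> {C \<in> barycentric_subdivision K. card C = Suc p}"
  then have "\<Union>C \<in> C"
    using assms by (intro finite_chain_has_top)
      (auto simp: barycentric_subdivision_def finite_simplicial_complex_def intro: finite_subset)
  with C assms have "C \<in> top_chains (\<Union>C) (Suc p)" "\<Union>C \<in> K"
    by (auto simp: top_chains_def barycentric_subdivision_def finite_simplicial_complex_def)
  then show "C \<in> (\<Union>s\<in>K. top_chains s (Suc p))" by blast
next
  fix C assume "C \<in> (\<Union>s\<in>K. top_chains s (Suc p))"
  then obtain s where s: "s \<in> K" "C \<in> top_chains s (Suc p)" by blast
  note C' = top_chainsD[OF s(2)]
  have "C \<subseteq> K"
  proof
    fix t assume "t \<in> C"
    then have "t \<subseteq> s" "t \<noteq> {}" using C'(1) by blast+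
    then show "t \<in> K" using assms s(1) unfolding finite_simplicial_complex_def by blast
  qed
  then show "C \<in> {C \<in> barycentric_subdivision K. card C = Suc p}"
    using C' by (auto simp: barycentric_subdivision_def)
qed

lemma inj_on_set_encode: "inj_on set_encode {s. finite s}"
  by (rule inj_onI) (simp add: set_encode_eq)

lemma Sd_simplex_inj:
  assumes "finite_simplicial_complex K"
  shows "inj_on set_encode K" "inj_on (\<lambda>C. set_encode ` C) (barycentric_subdivision K)"
proof -
  show inj: "inj_on set_encode K"
    using assms by (intro inj_on_subset[OF inj_on_set_encode]) (auto simp: finite_simplicial_complex_def)
  show "inj_on (\<lambda>C. set_encode ` C) (barycentric_subdivision K)"
    using inj_on_image_Pow[OF inj] by (rule inj_on_subset) (auto simp: barycentric_subdivision_def)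
qed

text \<open>The renaming of vertices preserves the number and the size of chains, and each chain is
  counted once, at its top.\<close>

lemma real_face_number_Sd:
  assumes K: "finite_simplicial_complex K"
  shows "real (face_number p (Sd K)) = (\<Sum>s\<in>K. lam (card s) (p + 1))"
proof -
  have card: "card (set_encode ` C) = card C" if "C \<in> barycentric_subdivision K" for C
    using that by (intro card_image inj_on_subset[OF Sd_simplex_inj(1)[OF K]])
      (auto simp: barycentric_subdivision_def)
  have "{s \<in> Sd K. card s = p + 1}
      = (\<lambda>C. set_encode ` C) ` {C \<in> barycentric_subdivision K. card C = Suc p}"
    using card by (auto simp: Sd_def)
  moreover have "inj_on (\<lambda>C. set_encode ` C) {C \<in> barycentric_subdivision K. card C = Suc p}"
    by (rule inj_on_subset[OF Sd_simplex_inj(2)[OF K]]) blast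
  ultimately have "face_number p (Sd K) = card {C \<in> barycentric_subdivision K. card C = Suc p}"
    by (simp add: face_number_def card_image)
  also have "\<dots> = (\<Sum>s\<in>K. card (top_chains s (Suc p)))"
    unfolding barycentric_subdivision_of_card[OF K]
  proof (rule card_UN_disjoint)
    show "finite K" "\<forall>s\<in>K. finite (top_chains s (Suc p))"
      using K unfolding finite_simplicial_complex_def by (blast intro: finite_top_chains)+
  qed (simp add: disjoint_top_chains)
  also have "real \<dots> = (\<Sum>s\<in>K. lam (card s) (Suc p))"
    using K unfolding of_nat_sum finite_simplicial_complex_def
    by (intro sum.cong refl card_top_chains) blast
  finally show ?thesis by simp
qed

lemma finite_simplicial_complex_Sd:
  assumes K: "finite_simplicial_complex K"
  shows "finite_simplicial_complex (Sd K)"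
  unfolding finite_simplicial_complex_def
proof (intro conjI ballI allI impI)
  have "finite K" using K by (simp add: finite_simplicial_complex_def)
  moreover have "barycentric_subdivision K \<subseteq> Pow K" by (auto simp: barycentric_subdivision_def)
  ultimately show "finite (Sd K)" unfolding Sd_def by (meson finite_Pow_iff finite_imageI finite_subset)
  fix s assume "s \<in> Sd K"
  then obtain C where C: "C \<in> barycentric_subdivision K" "s = set_encode ` C" by (auto simp: Sd_def)
  then have "C \<subseteq> K" "C \<noteq> {}" by (auto simp: barycentric_subdivision_def)
  with C \<open>finite K\<close> show "finite s" "s \<noteq> {}" by (simp_all add: finite_subset)
  fix t assume t: "t \<subseteq> s \<and> t \<noteq> {}"
  then obtain D where D: "D \<subseteq> C" "t = set_encode ` D" using C by (auto simp: subset_image_iff)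
  with t have "D \<noteq> {}" by auto
  with C(1) D(1) have "D \<in> barycentric_subdivision K"
    unfolding barycentric_subdivision_def mem_Collect_eq by (meson subset_iff)
  with D show "t \<in> Sd K" by (auto simp: Sd_def)
qed

lemma sum_card_eq_sum_face_number:
  fixes g :: "nat \<Rightarrow> real"
  assumes K: "finite_simplicial_complex K" and n: "\<forall>s\<in>K. card s \<le> n + 1"
  shows "(\<Sum>s\<in>K. g (card s)) = (\<Sum>h\<le>n. real (face_number h K) * g (h + 1))"
proof -
  \<comment> \<open>Simplices are nonempty, so the truncated subtraction \<open>card s - 1\<close>
    is the true dimension.\<close>
  have pos: "card s > 0" if "s \<in> K" for s
    using K that by (auto simp: finite_simplicial_complex_def card_gt_0_iff)
  have "(\<Sum>s\<in>K. g (card s)) = (\<Sum>h\<le>n. \<Sum>s | s \<in> K \<and> card s - 1 = h. g (card s))"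
    using K n by (intro sum.group[symmetric]) (auto simp: finite_simplicial_complex_def)
  also have "\<dots> = (\<Sum>h\<le>n. real (face_number h K) * g (h + 1))"
  proof (rule sum.cong[OF refl])
    fix h
    have "{s \<in> K. card s - 1 = h} = {s \<in> K. card s = h + 1}" using pos by force
    then show "(\<Sum>s | s \<in> K \<and> card s - 1 = h. g (card s)) = real (face_number h K) * g (h + 1)"
      by (simp add: face_number_def)
  qed
  finally show ?thesis .
qed

lemma has_dimension_face_number_pos:
  assumes "finite_simplicial_complex K" "has_dimension K n"
  shows "face_number n K > 0"
  using assms by (auto simp: face_number_def has_dimension_def finite_simplicial_complex_def card_gt_0_iff)

text \<open>Read off from the face count: \<open>lam j i\<close> vanishes for \<open>j < i\<close>,
  so no simplex of larger dimension is counted.\<close>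

lemma card_le_Sd:
  assumes K: "finite_simplicial_complex K" and n: "\<forall>s\<in>K. card s \<le> n + 1" and s: "s \<in> Sd K"
  shows "card s \<le> n + 1"
proof (rule ccontr)
  assume *: "\<not> card s \<le> n + 1"
  then obtain p where p: "card s = p + 1" "p > n" by (metis Suc_eq_plus1 not_le less_imp_Suc_add add_less_cancel_right)
  have "real (face_number p (Sd K)) = 0"
    unfolding real_face_number_Sd[OF K] using n p by (intro sum.neutral) (auto simp: lam_eq_0 le_imp_less_Suc intro!: lam_eq_0)
  then have "{s \<in> Sd K. card s = p + 1} = {}"
    using finite_simplicial_complex_Sd[OF K] by (simp add: face_number_def finite_simplicial_complex_def)
  with s p show False by auto
qed

section \<open>Limits of affine recurrences\<close>

text \<open>The limit is the fixed point of \<open>x \<mapsto> a * x + l\<close>; the distance to it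
  shrinks by the factor \<open>a\<close> up to the error of \<open>b\<close>.\<close>

lemma affine_recurrence_tendsto:
  fixes y b :: "nat \<Rightarrow> real"
  assumes rec: "\<And>d. y (Suc d) = a * y d + b d" and a: "0 \<le> a" "a < 1" and b: "b \<longlonglongrightarrow> l"
  shows "y \<longlonglongrightarrow> l / (1 - a)"
proof (rule LIMSEQ_I)
  fix r :: real assume r: "r > 0"
  define L where "L = l / (1 - a)"
  have L: "a * L + l = L" using a by (simp add: L_def field_simps)
  \<comment> \<open>With this tolerance \<open>r / 2\<close> is a fixed point of the error
    recursion, so the errors of \<open>b\<close> never add up to more than
    \<open>r / 2\<close>.\<close>
  have "r / 2 * (1 - a) > 0" using r a by simp
  from LIMSEQ_D[OF b this] obtain N where N: "\<And>d. d \<ge> N \<Longrightarrow> \<bar>b d - l\<bar> < r / 2 * (1 - a)"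
    by auto
  have bound: "\<bar>y (N + k) - L\<bar> \<le> a ^ k * \<bar>y N - L\<bar> + r / 2" for k
  proof (induction k)
    case 0
    then show ?case using r by simp
  next
    case (Suc k)
    have "y (N + Suc k) - L = a * (y (N + k) - L) + (b (N + k) - l)"
      using L rec[of "N + k"] by (simp add: algebra_simps)
    then have "\<bar>y (N + Suc k) - L\<bar> \<le> a * \<bar>y (N + k) - L\<bar> + \<bar>b (N + k) - l\<bar>"
      using abs_triangle_ineq[of "a * (y (N + k) - L)" "b (N + k) - l"] a by (simp add: abs_mult)
    also have "\<dots> \<le> a * (a ^ k * \<bar>y N - L\<bar> + r / 2) + r / 2 * (1 - a)"
      using N[of "N + k"] Suc a by (intro add_mono mult_left_mono) auto
    also have "\<dots> = a ^ Suc k * \<bar>y N - L\<bar> + r / 2" by (simp add: field_simps)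
    finally show ?case .
  qed
  have "(\<lambda>k. a ^ k * \<bar>y N - L\<bar>) \<longlonglongrightarrow> 0"
    using LIMSEQ_power_zero[of a] a by (intro tendsto_mult_left_zero) simp
  from LIMSEQ_D[OF this, of "r / 2"] r obtain M where "\<And>k. k \<ge> M \<Longrightarrow> a ^ k * \<bar>y N - L\<bar> < r / 2"
    using a by (auto simp: abs_mult)
  with bound have "\<bar>y (N + k) - L\<bar> < r" if "k \<ge> M" for k
    using that by (smt (verit) field_sum_of_halves)
  then show "\<exists>no. \<forall>d\<ge>no. norm (y d - l / (1 - a)) < r"
    unfolding L_def[symmetric] real_norm_def
    by (intro exI[of _ "N + M"]) (metis add.assoc le_Suc_ex le_add1)
qed

section \<open>Index chains and the triangular system\<close>

text \<open>One summand of the explicit formula. Lists count from zero, so \<open>ps ! k\<close> is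
  the entry of index \<open>k + 1\<close> of the chain.\<close>

definition chain_weight :: "nat \<Rightarrow> nat list \<Rightarrow> real" where
  "chain_weight n ps =
     (lam (n + 1) (last ps) * (\<Prod>k<length ps - 1. lam (ps ! (k + 1)) (ps ! k))) /
     (\<Prod>k<length ps. lam (n + 1) (n + 1) - lam (ps ! k) (ps ! k))"

text \<open>Extending a chain at its lower end keeps \<open>last ps\<close> and adds one factor to
  each product: one step of back substitution.\<close>

lemma chain_weight_Cons:
  assumes "ps \<noteq> []"
  shows "chain_weight n (x # ps) = lam (hd ps) x / (lam (n + 1) (n + 1) - lam x x) * chain_weight n ps"
proof -
  obtain y qs where "ps = y # qs" using assms by (cases ps) auto
  then show ?thesis
    unfolding chain_weight_def by (simp add: prod.lessThan_Suc_shift del: prod.lessThan_Suc)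
qed

text \<open>Classifies chains by their second entry \<open>h + 1\<close>, if there is one.\<close>

lemma index_chains_rec:
  assumes "p < n"
  shows "index_chains p n = insert [p + 1] (\<Union>h\<in>{p<..<n}. (#) (p + 1) ` index_chains h n)"
proof (intro equalityI subsetI)
  fix ps assume ps: "ps \<in> index_chains p n"
  then obtain qs where qs: "ps = (p + 1) # qs" by (cases ps) (auto simp: index_chains_def)
  show "ps \<in> insert [p + 1] (\<Union>h\<in>{p<..<n}. (#) (p + 1) ` index_chains h n)"
  proof (cases "qs = []")
    case False
    then have hd: "hd qs > p + 1" using ps qs by (auto simp: index_chains_def)
    have "hd qs \<le> last qs"
      using ps qs False by (cases qs) (auto simp: index_chains_def less_imp_le)
    moreover obtain h where h: "hd qs = h + 1" "p < h" using hd by (cases "hd qs") auto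
    ultimately have "h \<in> {p<..<n}" "qs \<in> index_chains h n"
      using ps qs False by (auto simp: index_chains_def)
    with qs show ?thesis by blast
  qed (use qs in simp)
next
  fix ps assume "ps \<in> insert [p + 1] (\<Union>h\<in>{p<..<n}. (#) (p + 1) ` index_chains h n)"
  then consider "ps = [p + 1]"
    | h qs where "h \<in> {p<..<n}" "qs \<in> index_chains h n" "ps = (p + 1) # qs" by auto
  then show "ps \<in> index_chains p n"
  proof cases
    case 1
    then show ?thesis using assms by (simp add: index_chains_def)
  next
    case 2
    then show ?thesis by (cases qs) (auto simp: index_chains_def)
  qed
qed

lemma finite_index_chains: "finite (index_chains p n)"
proof (rule finite_subset)
  show "index_chains p n \<subseteq> {ps. set ps \<subseteq> {..n} \<and> distinct ps}"
  proof
    fix ps assume ps: "ps \<in> index_chains p n"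
    have "x \<le> n" if "x \<in> set ps" for x
    proof -
      have "x \<le> last ps"
        using ps that by (cases ps rule: rev_cases) (auto simp: index_chains_def sorted_wrt_append less_imp_le)
      then show ?thesis using ps by (simp add: index_chains_def)
    qed
    then show "ps \<in> {ps. set ps \<subseteq> {..n} \<and> distinct ps}"
      using ps by (auto simp: index_chains_def strict_sorted_iff)
  qed
  show "finite {ps. set ps \<subseteq> {..n} \<and> distinct ps}" by (rule finite_subset_distinct) simp
qed

text \<open>The explicit formula serves as the definition, and the limit \<open>q\<close> is
  identified with it afterwards.\<close>

definition eigvec :: "nat \<Rightarrow> nat \<Rightarrow> real" where
  "eigvec n p = (if p < n then \<Sum>ps\<in>index_chains p n. chain_weight n ps
     else if p = n then 1 else 0)"

lemma fact_less_of_less: "p < n \<Longrightarrow> fact (p + 1) < (fact (n + 1) :: real)"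
  by (intro fact_less_mono) simp_all

text \<open>Row \<open>p\<close> of the eigenvector equation with its diagonal term moved to the
  left. Chains are grouped by second entry; the singleton chain supplies the term
  \<open>h = n\<close>, as \<open>eigvec n n = 1\<close>.\<close>

lemma eigvec_rec:
  assumes "p < n"
  shows "(fact (n + 1) - fact (p + 1)) * eigvec n p = (\<Sum>h\<in>{p<..n}. lam (h + 1) (p + 1) * eigvec n h)"
proof -
  let ?D = "fact (n + 1) - fact (p + 1) :: real"
  have D: "?D \<noteq> 0" using fact_less_of_less[OF assms] by simp
  have head: "qs \<noteq> []" "hd qs = h + 1" if "qs \<in> index_chains h n" for h qs
    using that by (auto simp: index_chains_def)
  have "eigvec n p = chain_weight n [p + 1]
      + (\<Sum>ps\<in>(\<Union>h\<in>{p<..<n}. (#) (p + 1) ` index_chains h n). chain_weight n ps)"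
    unfolding eigvec_def index_chains_rec[OF assms] using assms head
    by (simp, subst sum.insert) (auto simp: finite_index_chains)
  also have "(\<Sum>ps\<in>(\<Union>h\<in>{p<..<n}. (#) (p + 1) ` index_chains h n). chain_weight n ps)
      = (\<Sum>h\<in>{p<..<n}. \<Sum>ps\<in>(#) (p + 1) ` index_chains h n. chain_weight n ps)"
  proof (rule sum.UNION_disjoint)
    show "\<forall>h\<in>{p<..<n}. \<forall>h'\<in>{p<..<n}. h \<noteq> h' \<longrightarrow>
        (#) (p + 1) ` index_chains h n \<inter> (#) (p + 1) ` index_chains h' n = {}"
      using head(2) by (auto simp del: One_nat_def) (metis add_right_cancel)
  qed (simp_all add: finite_index_chains)
  also have "\<dots> = (\<Sum>h\<in>{p<..<n}. \<Sum>qs\<in>index_chains h n. lam (h + 1) (p + 1) / ?D * chain_weight n qs)"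
  proof (rule sum.cong[OF refl])
    fix h
    have "(\<Sum>ps\<in>(#) (p + 1) ` index_chains h n. chain_weight n ps)
        = (\<Sum>qs\<in>index_chains h n. chain_weight n ((p + 1) # qs))"
      by (subst sum.reindex) simp_all
    also have "\<dots> = (\<Sum>qs\<in>index_chains h n. lam (h + 1) (p + 1) / ?D * chain_weight n qs)"
      using head by (intro sum.cong refl) (simp add: chain_weight_Cons lam_diag del: fact_Suc)
    finally show "(\<Sum>ps\<in>(#) (p + 1) ` index_chains h n. chain_weight n ps)
        = (\<Sum>qs\<in>index_chains h n. lam (h + 1) (p + 1) / ?D * chain_weight n qs)" .
  qed
  also have "\<dots> = (\<Sum>h\<in>{p<..<n}. lam (h + 1) (p + 1) / ?D * eigvec n h)"
    by (simp add: eigvec_def sum_distrib_left)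
  also have "chain_weight n [p + 1] = lam (n + 1) (p + 1) / ?D"
    by (simp add: chain_weight_def lam_diag)
  finally have "?D * eigvec n p = lam (n + 1) (p + 1) + (\<Sum>h\<in>{p<..<n}. lam (h + 1) (p + 1) * eigvec n h)"
    using D by (simp add: distrib_left sum_distrib_left del: fact_Suc)
  moreover have "{p<..n} = insert n {p<..<n}" using assms by auto
  ultimately show ?thesis by (simp add: eigvec_def)
qed

section \<open>Convergence of the normalized face numbers\<close>

text \<open>Subdivision keeps the dimension bound, so grouping the simplices by dimension up to
  \<open>n\<close> is valid at every stage.\<close>

lemma face_number_iterated_Sd_rec:
  assumes K: "finite_simplicial_complex K" and n: "\<forall>s\<in>K. card s \<le> n + 1"
  shows "real (face_number p ((Sd ^^ Suc d) K))
    = (\<Sum>h\<le>n. lam (h + 1) (p + 1) * real (face_number h ((Sd ^^ d) K)))"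
proof -
  have "finite_simplicial_complex ((Sd ^^ d) K) \<and> (\<forall>s\<in>(Sd ^^ d) K. card s \<le> n + 1)"
  proof (induction d)
    case (Suc d)
    then show ?case
      using finite_simplicial_complex_Sd card_le_Sd by (metis comp_apply funpow.simps(2))
  qed (use K n in simp)
  then show ?thesis
    by (simp add: real_face_number_Sd sum_card_eq_sum_face_number[of _ n "\<lambda>k. lam k (p + 1)", simplified] mult.commute)
qed

lemma sum_lam_split:
  assumes "p \<le> n"
  shows "(\<Sum>h\<le>n. lam (h + 1) (p + 1) * v h)
    = fact (p + 1) * v p + (\<Sum>h\<in>{p<..n}. lam (h + 1) (p + 1) * v h)"
proof -
  have "(\<Sum>h\<le>n. lam (h + 1) (p + 1) * v h) = (\<Sum>h\<in>insert p {p<..n}. lam (h + 1) (p + 1) * v h)"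
    using assms by (intro sum.mono_neutral_right) (auto simp: lam_eq_0)
  then show ?thesis by (simp add: lam_diag)
qed

text \<open>Convergence at the larger indices makes the inhomogeneous term converge, and the
  resulting limit solves \<open>eigvec_rec\<close>.\<close>

lemma eigvec_tendsto:
  assumes K: "finite_simplicial_complex K" and n: "has_dimension K n" and p: "p \<le> n"
  shows "(\<lambda>d. real (face_number p ((Sd ^^ d) K)) / (fact (n + 1) ^ d * real (face_number n K)))
    \<longlonglongrightarrow> eigvec n p"
  using p
proof (induction "n - p" arbitrary: p rule: less_induct)
  case less
  define F :: real where "F = fact (n + 1)"
  define y where "y p d = real (face_number p ((Sd ^^ d) K)) / (F ^ d * real (face_number n K))" for p d
  have F: "F > 0" by (simp add: F_def)
  have fn: "real (face_number n K) > 0" using has_dimension_face_number_pos[OF K n] by simp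
  have IH: "y h \<longlonglongrightarrow> eigvec n h" if "h \<in> {p<..n}" for h
    using less.hyps[of h] that unfolding y_def F_def by (simp add: diff_less_mono2 del: fact_Suc)
  have "real (face_number p ((Sd ^^ Suc d) K)) = fact (p + 1) * real (face_number p ((Sd ^^ d) K))
      + (\<Sum>h\<in>{p<..n}. lam (h + 1) (p + 1) * real (face_number h ((Sd ^^ d) K)))" for d
    using face_number_iterated_Sd_rec[OF K, of n p d] n sum_lam_split[OF less.prems]
    by (simp add: has_dimension_def)
  then have rec: "y p (Suc d) = fact (p + 1) / F * y p d
      + (\<Sum>h\<in>{p<..n}. lam (h + 1) (p + 1) * y h d) / F" for d
    using F fn by (simp add: y_def field_simps sum_distrib_left sum_divide_distrib del: fact_Suc funpow.simps)
  show ?case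
  proof (cases "p = n")
    case True
    \<comment> \<open>Here the ratio \<open>a\<close> would be 1 and the affine lemma does not
      apply, but the inhomogeneous term is an empty sum, so the sequence is constant.\<close>
    have "y p d = 1" for d
    proof (induction d)
      case 0
      show ?case using True fn by (simp add: y_def)
    next
      case (Suc d)
      then show ?case using rec[of d] True F by (simp add: F_def)
    qed
    then have "y p = (\<lambda>d. 1)" by (rule ext)
    then have "y p \<longlonglongrightarrow> eigvec n p" using True by (simp add: eigvec_def)
    then show ?thesis unfolding y_def F_def .
  next
    case False
    then have "p < n" using less.prems by simp
    have lt: "fact (p + 1) < F" using fact_less_of_less[OF \<open>p < n\<close>] by (simp add: F_def)
    have "y p \<longlonglongrightarrow> (\<Sum>h\<in>{p<..n}. lam (h + 1) (p + 1) * eigvec n h) / F / (1 - fact (p + 1) / F)"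
    proof (rule affine_recurrence_tendsto)
      show "(\<lambda>d. (\<Sum>h\<in>{p<..n}. lam (h + 1) (p + 1) * y h d) / F)
          \<longlonglongrightarrow> (\<Sum>h\<in>{p<..n}. lam (h + 1) (p + 1) * eigvec n h) / F"
        using F IH by (intro tendsto_intros) simp_all
    qed (use rec F lt in simp_all)
    moreover have "(\<Sum>h\<in>{p<..n}. lam (h + 1) (p + 1) * eigvec n h) / F / (1 - fact (p + 1) / F) = eigvec n p"
      using eigvec_rec[OF \<open>p < n\<close>] F lt unfolding F_def[symmetric] by (simp add: field_simps)
    ultimately show ?thesis unfolding y_def F_def by simp
  qed
qed

text \<open>The full simplex witnesses that complexes of dimension \<open>n\<close> exist; without
  one, the universally quantified limit in \<open>q\<close> would not be determined.\<close>

lemma simplex_has_dimension: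
  "finite_simplicial_complex (Pow {..n} - {{}})" "has_dimension (Pow {..n} - {{}}) n"
proof -
  show "finite_simplicial_complex (Pow {..n} - {{}})"
    by (auto simp: finite_simplicial_complex_def intro: finite_subset)
  have "card s \<le> n + 1" if "s \<subseteq> {..n}" for s
    using card_mono[OF _ that] by simp
  then show "has_dimension (Pow {..n} - {{}}) n"
    unfolding has_dimension_def by (intro conjI bexI[of _ "{..n}"]) auto
qed

lemma q_eq_eigvec: "q p n = eigvec n p"
proof (cases "p \<le> n")
  case True
  show ?thesis
    unfolding q_def if_P[OF True]
  proof (rule the_equality)
    fix l
    assume "\<forall>K. finite_simplicial_complex K \<and> has_dimension K n \<longrightarrow>
      (\<lambda>d. real (face_number p ((Sd ^^ d) K)) / (fact (n + 1) ^ d * real (face_number n K))) \<longlonglongrightarrow> l"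
    then show "l = eigvec n p"
      using LIMSEQ_unique eigvec_tendsto[OF simplex_has_dimension True] simplex_has_dimension by blast
  qed (use eigvec_tendsto True in blast)
next
  case False
  then show ?thesis by (simp add: q_def eigvec_def)
qed

section \<open>The eigenvector equation and its unique solution\<close>

text \<open>Terms with \<open>h > n\<close> vanish through \<open>v\<close> and terms with
  \<open>h < p\<close> through \<open>lam\<close>, so the range can be exchanged for the finite
  \<open>{..n}\<close>.\<close>

lemma has_sum_lam_iff:
  assumes "p \<le> n" "\<forall>h>n. v h = 0"
  shows "((\<lambda>h. lam (h + 1) (p + 1) * v h) has_sum (fact (n + 1) * v p)) {p..} \<longleftrightarrow>
    (fact (n + 1) - fact (p + 1)) * v p = (\<Sum>h\<in>{p<..n}. lam (h + 1) (p + 1) * v h)"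
proof -
  have "((\<lambda>h. lam (h + 1) (p + 1) * v h) has_sum (fact (n + 1) * v p)) {p..} \<longleftrightarrow>
      ((\<lambda>h. lam (h + 1) (p + 1) * v h) has_sum (fact (n + 1) * v p)) {..n}"
    by (rule has_sum_cong_neutral) (use assms in \<open>auto simp: lam_eq_0\<close>)
  also have "\<dots> \<longleftrightarrow> (\<Sum>h\<le>n. lam (h + 1) (p + 1) * v h) = fact (n + 1) * v p"
    by (simp add: has_sum_finite_iff eq_commute)
  finally show ?thesis
    unfolding sum_lam_split[OF assms(1)] by (auto simp: algebra_simps simp del: fact_Suc)
qed

lemma eigvec_has_sum:
  "((\<lambda>h. lam (h + 1) (p + 1) * eigvec n h) has_sum (fact (n + 1) * eigvec n p)) {p..}"
proof (cases "p \<le> n")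
  case True
  then have "(fact (n + 1) - fact (p + 1)) * eigvec n p = (\<Sum>h\<in>{p<..n}. lam (h + 1) (p + 1) * eigvec n h)"
    using eigvec_rec[of p n] by (cases "p = n") auto
  then show ?thesis using True by (subst has_sum_lam_iff) (auto simp: eigvec_def)
next
  case False
  then show ?thesis by (auto simp: eigvec_def intro!: has_sum_0)
qed

text \<open>Back substitution from \<open>p = n\<close> downwards:
  \<open>fact (n + 1) - fact (p + 1)\<close> is nonzero, so row \<open>p\<close> determines
  \<open>v p\<close> from the later entries.\<close>

lemma eigenvector_unique:
  assumes v: "v n = 1" "\<forall>p>n. v p = 0"
    and sum: "\<And>p. ((\<lambda>h. lam (h + 1) (p + 1) * v h) has_sum (fact (n + 1) * v p)) {p..}"
  shows "v p = eigvec n p"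
proof (induction "n - p" arbitrary: p rule: less_induct)
  case less
  show ?case
  proof (cases "p < n")
    case True
    have "(fact (n + 1) - fact (p + 1)) * v p = (\<Sum>h\<in>{p<..n}. lam (h + 1) (p + 1) * v h)"
      using has_sum_lam_iff[of p n v] sum[of p] v(2) True by simp
    also have "\<dots> = (\<Sum>h\<in>{p<..n}. lam (h + 1) (p + 1) * eigvec n h)"
      using less by (intro sum.cong) auto
    also have "\<dots> = (fact (n + 1) - fact (p + 1)) * eigvec n p"
      using eigvec_rec[OF True] by simp
    finally show ?thesis using fact_less_of_less[OF True] by simp
  qed (use v in \<open>auto simp: eigvec_def\<close>)
qed

theorem theorem3:
  fixes n :: nat
  shows
    "q n n = 1 \<and>
     (\<forall>p>n. q p n = 0) \<and>
     (\<forall>p. ((\<lambda>h. lam (h + 1) (p + 1) * q h n) has_sum (fact (n + 1) * q p n)) {p..}) \<and>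
     (\<forall>v :: nat \<Rightarrow> real.
        v n = 1 \<and> (\<forall>p>n. v p = 0) \<and>
        (\<forall>p. ((\<lambda>h. lam (h + 1) (p + 1) * v h) has_sum (fact (n + 1) * v p)) {p..}) \<longrightarrow>
        v = (\<lambda>p. q p n)) \<and>
     (\<forall>p<n. q p n =
        (\<Sum>ps\<in>index_chains p n.
           (lam (n + 1) (last ps) * (\<Prod>k<length ps - 1. lam (ps ! (k + 1)) (ps ! k))) /
           (\<Prod>k<length ps. lam (n + 1) (n + 1) - lam (ps ! k) (ps ! k))))"
  unfolding q_eq_eigvec
proof (intro conjI allI impI)
  show "((\<lambda>h. lam (h + 1) (p + 1) * eigvec n h) has_sum (fact (n + 1) * eigvec n p)) {p..}" for p
    by (rule eigvec_has_sum)
  fix v :: "nat \<Rightarrow> real"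
  assume "v n = 1 \<and> (\<forall>p>n. v p = 0) \<and>
    (\<forall>p. ((\<lambda>h. lam (h + 1) (p + 1) * v h) has_sum (fact (n + 1) * v p)) {p..})"
  then show "v = (\<lambda>p. eigvec n p)"
    by (intro ext eigenvector_unique) blast+
\<comment> \<open>The normalization and the chain formula hold by definition of
  \<open>eigvec\<close>.\<close>
qed (simp_all add: eigvec_def chain_weight_def)

end
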